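(* Let $\mathbb{F}$ be a field, let $d=2$, and let $V$ be a vector space over $\mathbb{F}$ of dimension $d+1=3$. Let $\Phi = (A; \{E_i\}_{i=0}^2; A^*; \{E^*_i\}_{i=0}^2)$ be a Hessenberg system on $V$. Then $\Phi$ is TD.
   Context: $\mathrm{End}(V)$ is the algebra of $\mathbb{F}$-linear maps $V\to V$. An element of $\mathrm{End}(V)$ is multiplicity-free if it is diagonalizable and every eigenspace has dimension one. For multiplicity-free $A$ with eigenspaces ordered $V_0,\dots,V_d$, the corresponding primitive idempotents are $E_0,\dots,E_d \in \mathrm{End}(V)$, where $E_i$ acts as the identity on $V_i$ and as $0$ on $V_j$ for $j\neq i$. The superscript $*$ in $A^*$, $E_i^*$ is just notation (not an adjoint). A Hessenberg system on $V$ is a sequence $\Phi=(A; \{E_i\}_{i=0}^d; A^*; \{E^*_i\}_{i=0}^d)$ of elements of $\mathrm{End}(V)$ such that: (i) $A$ and $A^*$ are multiplicity-free; (ii) $\{E_i\}_{i=0}^d$ is an ordering of the primitive idempotents of $A$; (iii) $\{E^*_i\}_{i=0}^d$ is an ordering of the primitive idempotents of $A^*$; (iv) for $0\le i,j\le d$, $E_iA^*E_j=0$ if $i-j>1$ and $E_iA^*E_j\neq 0$ if $i-j=1$; (v) for $0\le i,j\le d$, $E^*_iAE^*_j=0$ if $i-j>1$ and $E^*_iAE^*_j\neq 0$ if $i-j=1$. A Hessenberg system $\Phi$ is TD if there exist scalars $\beta,\gamma,\gamma^*,\varrho,\varrho^*\in\mathbb{F}$ such that $$0=[A, A^2A^*-\beta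 AA^*A+A^*A^2-\gamma(AA^*+A^*A)-\varrho A^*],$$ $$0=[A^*, A^{*2}A-\beta A^*AA^*+AA^{*2}-\gamma^*(A^*A+AA^* )-\varrho^*A],$$ where $[X,Y]=XY-YX$. *)

theory Defs
  imports Complex_Main "HOL-Library.Function_Algebras"
begin

text \<open>
  The vector space \<open>V\<close> is a whole type \<open>'b\<close> with scalar multiplication \<open>scale\<close> over the field \<open>'a\<close>.
  Elements of \<open>End(V)\<close> are functions \<open>'b \<Rightarrow> 'b\<close> that are linear in the sense of
  \<^const>\<open>Vector_Spaces.linear\<close>; their sum, difference and zero are the pointwise ones from
  \<^theory>\<open>HOL-Library.Function_Algebras\<close>, and their product is composition (which binds weaker than \<open>+\<close> and \<open>-\<close>, hence the parentheses).
\<close>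

locale endomorphisms = vector_space scale
  for scale :: "'a::field \<Rightarrow> 'b::ab_group_add \<Rightarrow> 'b"
begin

definition End :: "('b \<Rightarrow> 'b) set" where
  "End = {X. Vector_Spaces.linear scale scale X}"

definition scale_map :: "'a \<Rightarrow> ('b \<Rightarrow> 'b) \<Rightarrow> 'b \<Rightarrow> 'b" (infixr "*m" 75) where
  "c *m X = (\<lambda>v. scale c (X v))"

definition commutator :: "('b \<Rightarrow> 'b) \<Rightarrow> ('b \<Rightarrow> 'b) \<Rightarrow> 'b \<Rightarrow> 'b" where
  "commutator X Y = (X \<circ> Y) - (Y \<circ> X)"

definition eigenspace :: "('b \<Rightarrow> 'b) \<Rightarrow> 'a \<Rightarrow> 'b set" where
  "eigenspace X \<theta> = {v. X v = scale \<theta> v}"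

definition eigenvalue :: "('b \<Rightarrow> 'b) \<Rightarrow> 'a \<Rightarrow> bool" where
  "eigenvalue X \<theta> \<longleftrightarrow> (\<exists>v. v \<noteq> 0 \<and> X v = scale \<theta> v)"

definition eigenspaces :: "('b \<Rightarrow> 'b) \<Rightarrow> 'b set set" where
  "eigenspaces X = {eigenspace X \<theta> | \<theta>. eigenvalue X \<theta>}"

definition diagonalizable :: "('b \<Rightarrow> 'b) \<Rightarrow> bool" where
  "diagonalizable X \<longleftrightarrow>
     (\<exists>B. independent B \<and> span B = UNIV \<and> (\<forall>v\<in>B. \<exists>\<theta>. X v = scale \<theta> v))"

definition multiplicity_free :: "('b \<Rightarrow> 'b) \<Rightarrow> bool" where
  "multiplicity_free X \<longleftrightarrow>
     X \<in> End \<and> diagonalizable X \<and> (\<forall>W\<in>eigenspaces X. dim W = 1)"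

text \<open>
  \<open>E 0, \<dots>, E d\<close> is an ordering of the primitive idempotents of \<open>X\<close>: these correspond to an ordering
  \<open>W 0, \<dots>, W d\<close> of the eigenspaces of \<open>X\<close>. Values of \<open>E\<close> beyond index \<open>d\<close> are irrelevant.
\<close>

definition primitive_idempotents ::
    "nat \<Rightarrow> ('b \<Rightarrow> 'b) \<Rightarrow> (nat \<Rightarrow> 'b \<Rightarrow> 'b) \<Rightarrow> bool" where
  "primitive_idempotents d X E \<longleftrightarrow>
     (\<exists>W. bij_betw W {0..d} (eigenspaces X) \<and>
        (\<forall>i\<in>{0..d}. E i \<in> End \<and>
           (\<forall>v\<in>W i. E i v = v) \<and>
           (\<forall>j\<in>{0..d}. j \<noteq> i \<longrightarrow> (\<forall>v\<in>W j. E i v = 0))))"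

definition hessenberg_system ::
    "nat \<Rightarrow> ('b \<Rightarrow> 'b) \<Rightarrow> (nat \<Rightarrow> 'b \<Rightarrow> 'b) \<Rightarrow> ('b \<Rightarrow> 'b) \<Rightarrow> (nat \<Rightarrow> 'b \<Rightarrow> 'b) \<Rightarrow> bool" where
  "hessenberg_system d A E As Es \<longleftrightarrow>
     multiplicity_free A \<and> multiplicity_free As \<and>
     primitive_idempotents d A E \<and>
     primitive_idempotents d As Es \<and>
     (\<forall>i\<in>{0..d}. \<forall>j\<in>{0..d}.
        (int i - int j > 1 \<longrightarrow> E i \<circ> As \<circ> E j = 0) \<and>
        (int i - int j = 1 \<longrightarrow> E i \<circ> As \<circ> E j \<noteq> 0)) \<and>
     (\<forall>i\<in>{0..d}. \<forall>j\<in>{0..d}.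
        (int i - int j > 1 \<longrightarrow> Es i \<circ> A \<circ> Es j = 0) \<and>
        (int i - int j = 1 \<longrightarrow> Es i \<circ> A \<circ> Es j \<noteq> 0))"

text \<open>Being TD depends on a Hessenberg system only through \<open>A\<close> and \<open>A\<^sup>*\<close>.\<close>

definition TD :: "('b \<Rightarrow> 'b) \<Rightarrow> ('b \<Rightarrow> 'b) \<Rightarrow> bool" where
  "TD A As \<longleftrightarrow>
     (\<exists>\<beta> \<gamma> \<gamma>s \<rho> \<rho>s.
        0 = commutator A
              ((A \<circ> A \<circ> As) - \<beta> *m (A \<circ> As \<circ> A) + (As \<circ> A \<circ> A)
               - \<gamma> *m ((A \<circ> As) + (As \<circ> A)) - \<rho> *m As) \<and>
        0 = commutator As
              ((As \<circ> As \<circ> A) - \<beta> *m (As \<circ> A \<circ> As) + (A \<circ> As \<circ> As)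
               - \<gamma>s *m ((As \<circ> A) + (A \<circ> As)) - \<rho>s *m A))"

end

end

theory Submission
  imports Defs
begin

text \<open>
  Only dimension three and diagonalizability matter. An endomorphism \<open>A\<close> of a three-dimensional
  space satisfies a cubic \<open>A\<^sup>3 = e\<^sub>1 A\<^sup>2 - e\<^sub>2 A + e\<^sub>3\<close>. For \<open>\<beta> = -1\<close> the commutator telescopes:
  \<open>[A, A\<^sup>2B + ABA + BA\<^sup>2 - e\<^sub>1(AB + BA) + e\<^sub>2B] = [A\<^sup>3 - e\<^sub>1A\<^sup>2 + e\<^sub>2A, B] = [e\<^sub>3, B] = 0\<close>.
  As \<open>\<beta> = -1\<close> serves any cubic, it serves \<open>A\<close> and \<open>A\<^sup>*\<close> simultaneously.
\<close>

context endomorphisms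
begin

text \<open>An eigenbasis has three vectors, and the monic cubic with their eigenvalues as roots
  annihilates each of them. Both sides are linear in \<open>v\<close>, so the identity spreads from
  the basis to its span.\<close>

lemma diagonalizable_dim3_cubic:
  assumes lin: "X \<in> End" and diag: "diagonalizable X" and dim: "dim UNIV = 3"
  obtains e1 e2 e3 where
    "\<And>v. X (X (X v)) = scale e1 (X (X v)) - scale e2 (X v) + scale e3 v"
proof -
  interpret X: Vector_Spaces.linear scale scale X
    using lin by (simp add: End_def)
  obtain B where B: "independent B" "span B = UNIV" "\<forall>v\<in>B. \<exists>\<theta>. X v = scale \<theta> v"
    using diag by (auto simp: diagonalizable_def)
  have "card B = 3"
    using B dim basis_card_eq_dim[of B UNIV] by auto
  then obtain x y z where xyz: "B = {x, y, z}"
    by (auto simp: card_3_iff)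
  obtain p q r where eig: "X x = scale p x" "X y = scale q y" "X z = scale r z"
    using B(3) xyz by auto
  \<comment> \<open>Elementary symmetric functions: \<open>(t - p) * (t - q) * (t - r)\<close>
    expands to \<open>t^3 - e1 * t^2 + e2 * t - e3\<close>.\<close>
  define e1 e2 e3 where "e1 = p + q + r" and "e2 = p * q + q * r + r * p" and "e3 = p * q * r"
  have root: "t * (t * t) = e1 * (t * t) - e2 * t + e3" if "t \<in> {p, q, r}" for t
    using that unfolding e1_def e2_def e3_def by (auto simp: algebra_simps)
  have on_eigenvector: "X (X (X v)) = scale e1 (X (X v)) - scale e2 (X v) + scale e3 v"
    if "X v = scale t v" "t \<in> {p, q, r}" for v t
  proof -
    have "X (X (X v)) = scale (t * (t * t)) v"
      by (simp add: that(1) X.scale mult.assoc)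
    also have "\<dots> = scale e1 (X (X v)) - scale e2 (X v) + scale e3 v"
      by (simp add: root[OF that(2)] that(1) X.scale scale_left_distrib scale_left_diff_distrib)
    finally show ?thesis .
  qed
  have "X (X (X v)) = scale e1 (X (X v)) - scale e2 (X v) + scale e3 v" for v
  proof -
    have "v \<in> span B"
      using B(2) by simp
    then show ?thesis
    proof (induction rule: span_induct_alt)
      case base
      show ?case by (simp add: X.zero)
    next
      case (step c u w)
      then have "X (X (X u)) = scale e1 (X (X u)) - scale e2 (X u) + scale e3 u"
        using xyz eig on_eigenvector by auto
      with step.IH show ?case
        by (simp add: X.add X.scale scale_right_distrib scale_right_diff_distrib mult.commute)
    qed
  qed
  then show thesis by (rule that)
qed

text \<open>The signs follow the shape of \<open>TD\<close>: \<open>- 1\<close>, \<open>e1\<close>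
  and \<open>- e2\<close> stand in the places of \<beta>, \<gamma> and \<rho>.\<close>

lemma cubic_commutator_eq_0:
  assumes "X \<in> End" "Y \<in> End"
    and cubic: "\<And>v. X (X (X v)) = scale e1 (X (X v)) - scale e2 (X v) + scale e3 v"
  shows "commutator X
           ((X \<circ> X \<circ> Y) - (- 1) *m (X \<circ> Y \<circ> X) + (Y \<circ> X \<circ> X)
            - e1 *m ((X \<circ> Y) + (Y \<circ> X)) - (- e2) *m Y) = 0"
proof -
  interpret X: Vector_Spaces.linear scale scale X
    using assms by (simp add: End_def)
  interpret Y: Vector_Spaces.linear scale scale Y
    using assms by (simp add: End_def)
  show ?thesis
    \<comment> \<open>After \<open>cubic\<close> has removed the third powers of \<open>X\<close>,
      linearity of \<open>Y\<close> makes the remaining terms cancel, those with \<open>e3\<close>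
      included.\<close>
    by (simp add: fun_eq_iff commutator_def scale_map_def cubic X.add X.diff X.scale X.neg
        Y.add Y.diff Y.scale scale_right_distrib algebra_simps)
qed

lemma diagonalizable_dim3_TD:
  assumes "X \<in> End" "diagonalizable X" "Y \<in> End" "diagonalizable Y" "dim UNIV = 3"
  shows "TD X Y"
proof -
  obtain e1 e2 e3 where
    X: "\<And>v. X (X (X v)) = scale e1 (X (X v)) - scale e2 (X v) + scale e3 v"
    using diagonalizable_dim3_cubic assms(1,2,5) by blast
  obtain f1 f2 f3 where
    Y: "\<And>v. Y (Y (Y v)) = scale f1 (Y (Y v)) - scale f2 (Y v) + scale f3 v"
    using diagonalizable_dim3_cubic assms(3-5) by blast
  \<comment> \<open>The witnesses are \<beta> = -1, shared by both relations, \<gamma> =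
    \<open>e1\<close>, \<rho> = \<open>- e2\<close> from the cubic of \<open>X\<close>, and
    \<open>\<gamma>s\<close> = \<open>f1\<close>, \<open>\<rho>s\<close> = \<open>- f2\<close> from
    that of \<open>Y\<close>.\<close>
  show ?thesis
    unfolding TD_def
    using cubic_commutator_eq_0[OF assms(1,3) X] cubic_commutator_eq_0[OF assms(3,1) Y]
    by metis
qed

end

theorem proposition11p8:
  fixes scale :: "'a::field \<Rightarrow> 'b::ab_group_add \<Rightarrow> 'b"
    and d :: nat
    and A As :: "'b \<Rightarrow> 'b"
    and E Es :: "nat \<Rightarrow> 'b \<Rightarrow> 'b"
  assumes "vector_space scale"
    and "d = 2"
    and "vector_space.dim scale (UNIV :: 'b set) = d + 1"
    and "endomorphisms.hessenberg_system scale d A E As Es"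
  shows "endomorphisms.TD scale A As"
proof -
  interpret endomorphisms scale
    using assms(1) by (rule endomorphisms.intro)
  show ?thesis
    using assms(2-4) diagonalizable_dim3_TD
    by (simp add: hessenberg_system_def multiplicity_free_def)
qed

end
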